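(* Let $\nu$ be a locally finite Borel measure on $\mathbb{R}^d$, let $Q=[0,1)^d$ and let $r>0$. For each $k\in\mathbb{Z}^d$, let $x_k$ be a point in $r(k+Q)$. Define the measure $$\nu'=\sum_{k\in\mathbb{Z}^d}\nu(r(k+Q))\,\delta_{x_k}.$$ Then $\dim\nu'=\dim\nu$, where $\dim$ denotes the (upper) Beurling dimension.
   Context: A Borel measure on $\mathbb{R}^d$ is locally finite if it is finite on compact sets; $\delta_a$ is the Dirac measure at $a$. For a locally finite measure $\nu$ on $\mathbb{R}^d$ and $\alpha\ge 0$, the $\alpha$-upper Beurling density is $$\mathcal{D}_\alpha(\nu)=\limsup_{R\to\infty}\sup_{x\in\mathbb{R}^d}\frac{\nu(x+RQ)}{R^\alpha}\in[0,\infty],$$ and the (upper) Beurling dimension is $\dim\nu=\sup\{\alpha\ge 0:\mathcal{D}_\alpha(\nu)=\infty\}$, with the convention $\sup\emptyset=0$. *)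

theory Defs
  imports "HOL-Probability.Giry_Monad"
begin

definition unit_cube :: "(real ^ 'n) set" where
  "unit_cube = {q. \<forall>i. 0 \<le> q $ i \<and> q $ i < 1}"

definition lattice_vec :: "int ^ 'n \<Rightarrow> real ^ 'n" where
  "lattice_vec k = (\<chi> i. real_of_int (k $ i))"

definition lattice_cell :: "real \<Rightarrow> int ^ 'n \<Rightarrow> (real ^ 'n) set" where
  "lattice_cell r k = (\<lambda>q. r *\<^sub>R (lattice_vec k + q)) ` unit_cube"

definition locally_finite_measure :: "'a::topological_space measure \<Rightarrow> bool" where
  "locally_finite_measure \<nu> \<longleftrightarrow> (\<forall>K. compact K \<longrightarrow> emeasure \<nu> K < \<infinity>)"

(* Only large R matter, and there R powr \<alpha> > 0 (also for \<alpha> = 0), so the quotient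
   in ennreal is the genuine one. *)
definition upper_beurling_density :: "real \<Rightarrow> (real ^ 'n) measure \<Rightarrow> ennreal" where
  "upper_beurling_density \<alpha> \<nu> =
     Limsup at_top (\<lambda>R::real. SUP x. emeasure \<nu> ((\<lambda>q. x + R *\<^sub>R q) ` unit_cube) / ennreal (R powr \<alpha>))"

(* The dimension may be infinite; in ennreal the supremum of the empty set is 0. *)
definition beurling_dim :: "(real ^ 'n) measure \<Rightarrow> ennreal" where
  "beurling_dim \<nu> = (SUP \<alpha>\<in>{\<alpha>. 0 \<le> \<alpha> \<and> upper_beurling_density \<alpha> \<nu> = \<infinity>}. ennreal \<alpha>)"

definition borel_measure_sum :: "('i \<Rightarrow> 'a::topological_space measure) \<Rightarrow> 'a measure" where
  "borel_measure_sum M = measure_of UNIV (sets borel) (\<lambda>A. \<Sum>\<^sub>\<infinity>k. emeasure (M k) A)"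

lemma sets_borel_measure_sum [simp]: "sets (borel_measure_sum M) = sets borel"
  unfolding borel_measure_sum_def
  by (metis sets.sets_measure_of_eq space_borel)

(* measure_of yields the zero measure on set functions that are not countably additive;
   this lemma excludes that degenerate case. *)
lemma emeasure_borel_measure_sum:
  fixes M :: "'b \<Rightarrow> 'a::topological_space measure"
  assumes "\<And>k. sets (M k) = sets borel" and "A \<in> sets borel"
  shows "emeasure (borel_measure_sum M) A = (\<Sum>\<^sub>\<infinity>k. emeasure (M k) A)"
  unfolding borel_measure_sum_def
proof (rule emeasure_measure_of_sigma)
  show "sigma_algebra UNIV (sets borel :: 'a set set)"
    by (metis sets.sigma_algebra_axioms space_borel)
  show "positive (sets borel) (\<lambda>A. \<Sum>\<^sub>\<infinity>k. emeasure (M k) A)"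
    by (simp add: positive_def)
  show "countably_additive (sets borel) (\<lambda>A. \<Sum>\<^sub>\<infinity>k. emeasure (M k) A)"
  proof (rule countably_additiveI)
    fix B :: "nat \<Rightarrow> 'a set"
    assume B: "range B \<subseteq> sets borel" "disjoint_family B"
    have inf: "(\<Sum>\<^sub>\<infinity>k. f k) = (SUP F\<in>Collect finite. sum f F)" for f :: "'b \<Rightarrow> ennreal"
      by (subst nonneg_infsum_complete) auto
    have "(\<Sum>j. \<Sum>\<^sub>\<infinity>k. emeasure (M k) (B j))
        = (\<Sum>j. SUP F\<in>Collect finite. \<Sum>k\<in>F. emeasure (M k) (B j))"
      by (simp add: inf)
    also have "\<dots> = (SUP F\<in>Collect finite. \<Sum>j. \<Sum>k\<in>F. emeasure (M k) (B j))"
    proof (rule ennreal_suminf_SUP_eq_directed)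
      fix N :: "nat set" and F G :: "'b set"
      assume FG: "F \<in> Collect finite" "G \<in> Collect finite"
      then show "\<exists>H\<in>Collect finite. \<forall>j\<in>N.
          (\<Sum>k\<in>F. emeasure (M k) (B j)) \<le> (\<Sum>k\<in>H. emeasure (M k) (B j)) \<and>
          (\<Sum>k\<in>G. emeasure (M k) (B j)) \<le> (\<Sum>k\<in>H. emeasure (M k) (B j))"
        by (intro bexI[of _ "F \<union> G"]) (auto intro!: sum_mono2)
    qed
    also have "\<dots> = (SUP F\<in>Collect finite. \<Sum>k\<in>F. \<Sum>j. emeasure (M k) (B j))"
      by (simp add: suminf_sum)
    also have "\<dots> = (SUP F\<in>Collect finite. \<Sum>k\<in>F. emeasure (M k) (\<Union>(range B)))"
      using B assms(1) by (simp add: suminf_emeasure)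
    also have "\<dots> = (\<Sum>\<^sub>\<infinity>k. emeasure (M k) (\<Union>(range B)))"
      by (simp add: inf)
    finally show "(\<Sum>j. \<Sum>\<^sub>\<infinity>k. emeasure (M k) (B j)) = (\<Sum>\<^sub>\<infinity>k. emeasure (M k) (\<Union>(range B)))" .
  qed
qed (use assms in auto)

end

theory Submission
  imports Defs
begin

text \<open>
  Moving the mass of a cell of side \<open>r\<close> to a point of that cell moves no mass by more than \<open>r\<close> in
  any coordinate. Since the discretised measure gives a set \<open>A\<close> the \<open>\<nu>\<close>-mass of the union of the
  cells whose chosen point lies in \<open>A\<close>
  (\<open>emeasure_discretisation\<close>), each of \<open>\<nu>\<close> and \<open>\<nu>'\<close> gives a cube of side \<open>R\<close> at most the mass that
  the other one gives to that cube enlarged by \<open>r\<close> on every side. Once \<open>R \<ge> 2 * r\<close>, the enlarged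
  cube fits into a cube of side \<open>2 * R\<close>. Doubling the side changes \<open>R powr \<alpha>\<close> only by the constant
  factor \<open>2 powr \<alpha>\<close>, so it does not affect whether the \<open>\<alpha>\<close>-density is infinite
  (\<open>beurling_dim_mono_of_doubled_cubes\<close>), and only this matters for the dimension.
\<close>

section \<open>Half-open cubes and lattice cells\<close>

definition half_open_cube :: "real ^ 'n \<Rightarrow> real \<Rightarrow> (real ^ 'n) set" where
  "half_open_cube a R = {y. \<forall>i. a $ i \<le> y $ i \<and> y $ i < a $ i + R}"

lemma half_open_cube_eq_image:
  assumes "R > 0"
  shows "(\<lambda>q. a + R *\<^sub>R q) ` unit_cube = half_open_cube a R"
proof (intro equalityI subsetI)
  fix y assume "y \<in> half_open_cube a R"
  then have "(1 / R) *\<^sub>R (y - a) \<in> unit_cube"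
    using assms by (auto simp: half_open_cube_def unit_cube_def field_simps)
  moreover have "y = a + R *\<^sub>R ((1 / R) *\<^sub>R (y - a))"
    using assms by simp
  ultimately show "y \<in> (\<lambda>q. a + R *\<^sub>R q) ` unit_cube"
    by (rule rev_image_eqI)
qed (use assms in \<open>auto simp: half_open_cube_def unit_cube_def\<close>)

lemma half_open_cube_borel [measurable]: "half_open_cube a R \<in> sets borel"
proof -
  have "half_open_cube a R =
      (\<Inter>i. (\<lambda>y. y $ i) -` {a $ i ..< a $ i + R} \<inter> space borel)"
    by (auto simp: half_open_cube_def)
  also have "\<dots> \<in> sets borel"
    by (intro sets.finite_INT measurable_sets[OF borel_measurable_continuous_onI])
      (auto intro!: continuous_intros)
  finally show ?thesis .
qed

lemma lattice_cell_eq_half_open_cube: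
  assumes "r > 0"
  shows "lattice_cell r k = half_open_cube (r *\<^sub>R lattice_vec k) r"
  using half_open_cube_eq_image[OF assms, of "r *\<^sub>R lattice_vec k"]
  by (simp add: lattice_cell_def scaleR_right_distrib)

lemma lattice_cell_borel:
  assumes "r > 0"
  shows "lattice_cell r k \<in> sets borel"
  by (simp add: lattice_cell_eq_half_open_cube[OF assms] half_open_cube_borel)

lemma mem_lattice_cell_iff:
  assumes "r > 0"
  shows "y \<in> lattice_cell r k \<longleftrightarrow> (\<forall>i. \<lfloor>y $ i / r\<rfloor> = k $ i)"
  using assms
  by (auto simp: lattice_cell_eq_half_open_cube half_open_cube_def lattice_vec_def
      floor_eq_iff field_simps)

lemma lattice_cells_cover:
  assumes "r > 0"
  obtains k where "y \<in> lattice_cell r k"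
  using mem_lattice_cell_iff[OF assms, of y "\<chi> i. \<lfloor>y $ i / r\<rfloor>"] by auto

lemma lattice_cells_disjoint:
  assumes "r > 0" "y \<in> lattice_cell r k" "y \<in> lattice_cell r l"
  shows "k = l"
  using assms by (simp add: mem_lattice_cell_iff vec_eq_iff)

text \<open>
  Two points of one cell differ by less than \<open>r\<close> in each coordinate, so lowering the corner by \<open>r\<close> and
  lengthening the side by \<open>2 * r \<le> R\<close> catches every cell that meets the cube.
\<close>

lemma half_open_cube_enlarge:
  assumes r: "r > 0" and R: "R \<ge> 2 * r"
    and "y \<in> half_open_cube a R" and "y \<in> lattice_cell r k" and "z \<in> lattice_cell r k"
  shows "z \<in> half_open_cube (a - (\<chi> i. r)) (2 * R)"
proof -
  have "a $ i - r \<le> z $ i \<and> z $ i < a $ i - r + 2 * R" for i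
  proof -
    have "a $ i \<le> y $ i" "y $ i < a $ i + R"
      "r * k $ i \<le> y $ i" "y $ i < r * k $ i + r" "r * k $ i \<le> z $ i" "z $ i < r * k $ i + r"
      using assms
      by (auto simp: lattice_cell_eq_half_open_cube half_open_cube_def lattice_vec_def)
    then show ?thesis using R by linarith
  qed
  then show ?thesis by (simp add: half_open_cube_def)
qed

section \<open>Mass of the discretised measure\<close>

text \<open>
  An enumeration of the index type turns the unordered sum into a series; indices outside the range
  of \<open>to_nat\<close> contribute the empty set.
\<close>

lemma emeasure_UN_eq_infsum:
  fixes X :: "'i::countable \<Rightarrow> 'a set"
  assumes "\<And>i. i \<in> I \<Longrightarrow> X i \<in> sets M" and "disjoint_family_on X I"
  shows "emeasure M (\<Union>i\<in>I. X i) = (\<Sum>\<^sub>\<infinity>i\<in>I. emeasure M (X i))"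
proof -
  define C where "C n = (if n \<in> to_nat ` I then X (from_nat n) else {})" for n
  have "emeasure M (\<Union>i\<in>I. X i) = emeasure M (\<Union>n. C n)"
    by (rule arg_cong[where f = "emeasure M"]) (auto simp: C_def split: if_splits)
  also have "\<dots> = (\<Sum>n. emeasure M (C n))"
    using assms by (intro suminf_emeasure[symmetric])
      (fastforce simp: C_def disjoint_family_on_def)+
  also have "\<dots> = (\<Sum>\<^sub>\<infinity>n. emeasure M (C n))"
    by (intro sums_unique[symmetric] has_sum_imp_sums has_sum_infsum
        nonneg_summable_on_complete) simp
  also have "\<dots> = (\<Sum>\<^sub>\<infinity>n\<in>to_nat ` I. emeasure M (C n))"
    by (rule infsum_cong_neutral) (auto simp: C_def)
  also have "\<dots> = (\<Sum>\<^sub>\<infinity>i\<in>I. emeasure M (X i))"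
    by (subst infsum_reindex) (auto intro!: infsum_cong simp: C_def)
  finally show ?thesis .
qed

text \<open>
  Each summand is the mass of its whole cell or zero, according to whether its point lies in \<open>A\<close>;
  the cells being disjoint, the masses add up to the mass of the union. Any inequality between
  the two measures is thereby reduced to an inclusion of sets.
\<close>

lemma emeasure_discretisation:
  fixes \<nu> :: "(real ^ 'n) measure" and x :: "int ^ 'n \<Rightarrow> real ^ 'n"
  assumes "sets \<nu> = sets borel" and "r > 0" and "A \<in> sets borel"
  shows "emeasure (borel_measure_sum
           (\<lambda>k. scale_measure (emeasure \<nu> (lattice_cell r k)) (return borel (x k)))) A
         = emeasure \<nu> (\<Union>k\<in>{k. x k \<in> A}. lattice_cell r k)"
proof -
  have "emeasure \<nu> (\<Union>k\<in>{k. x k \<in> A}. lattice_cell r k)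
      = (\<Sum>\<^sub>\<infinity>k\<in>{k. x k \<in> A}. emeasure \<nu> (lattice_cell r k))"
  proof (rule emeasure_UN_eq_infsum)
    show "disjoint_family_on (lattice_cell r) {k. x k \<in> A}"
      using lattice_cells_disjoint[OF \<open>r > 0\<close>] unfolding disjoint_family_on_def by blast
  qed (use assms lattice_cell_borel in \<open>simp\<close>)
  also have "\<dots> = (\<Sum>\<^sub>\<infinity>k. emeasure \<nu> (lattice_cell r k) * indicator A (x k))"
    by (rule infsum_cong_neutral) auto
  finally show ?thesis
    using assms(3) by (simp add: emeasure_borel_measure_sum)
qed

section \<open>Comparison of Beurling dimensions\<close>

lemma upper_beurling_density_eq_cubes:
  fixes \<mu> :: "(real ^ 'n) measure"
  shows "upper_beurling_density \<alpha> \<mu> =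
    Limsup at_top (\<lambda>R. SUP a. emeasure \<mu> (half_open_cube a R) / ennreal (R powr \<alpha>))"
  unfolding upper_beurling_density_def
  by (rule Limsup_eq, rule eventually_mono[OF eventually_gt_at_top[of 0]])
    (simp add: half_open_cube_eq_image)

text \<open>
  If the density of \<open>\<mu>\<close> is finite, its quotients are eventually below a constant \<open>C\<close>; the
  hypothesis at side \<open>R\<close> then bounds the quotients of \<open>\<rho>\<close> by \<open>2 powr \<alpha> * C\<close>.
\<close>

lemma upper_beurling_density_infinite_mono:
  fixes \<rho> \<mu> :: "(real ^ 'n) measure"
  assumes bound: "eventually (\<lambda>R. \<forall>a. \<exists>b.
      emeasure \<rho> (half_open_cube a R) \<le> emeasure \<mu> (half_open_cube b (2 * R))) at_top"
    and inf: "upper_beurling_density \<alpha> \<rho> = \<infinity>"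
  shows "upper_beurling_density \<alpha> \<mu> = \<infinity>"
proof (rule ccontr)
  let ?f = "\<lambda>R. SUP a. emeasure \<mu> (half_open_cube a R) / ennreal (R powr \<alpha>)"
  assume "upper_beurling_density \<alpha> \<mu> \<noteq> \<infinity>"
  then have "Limsup at_top ?f < \<infinity>"
    by (simp add: upper_beurling_density_eq_cubes less_top)
  then obtain C where C: "Limsup at_top ?f < C" "C < \<infinity>"
    using dense by blast
  have ev: "eventually (\<lambda>R. ?f R < C) at_top"
    by (rule Limsup_lessD[OF C(1)])
  have "filterlim (\<lambda>R::real. 2 * R) at_top at_top"
    by (rule filterlim_tendsto_pos_mult_at_top[OF tendsto_const _ filterlim_ident]) simp
  then have "eventually (\<lambda>R. ?f (2 * R) < C) at_top"
    using ev by (rule eventually_compose_filterlim[rotated])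
  then have "eventually (\<lambda>R. (SUP a. emeasure \<rho> (half_open_cube a R) / ennreal (R powr \<alpha>))
      \<le> ennreal (2 powr \<alpha>) * C) at_top"
    using bound eventually_gt_at_top[of 0]
  proof eventually_elim
    case (elim R)
    show ?case
    proof (rule SUP_least)
      fix a
      from elim(2) obtain b where
        b: "emeasure \<rho> (half_open_cube a R) \<le> emeasure \<mu> (half_open_cube b (2 * R))" by blast
      let ?m = "emeasure \<mu> (half_open_cube b (2 * R))"
      have split: "ennreal ((2 * R) powr \<alpha>) = ennreal (2 powr \<alpha>) * ennreal (R powr \<alpha>)"
        using elim(3) by (simp add: powr_mult ennreal_mult)
      have "emeasure \<rho> (half_open_cube a R) / ennreal (R powr \<alpha>) \<le> ?m / ennreal (R powr \<alpha>)"
        by (rule divide_right_mono_ennreal[OF b])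
      also have "\<dots> = ennreal (2 powr \<alpha>) * (?m / ennreal ((2 * R) powr \<alpha>))"
        unfolding split ennreal_times_divide
        using divide_mult_eq[of "ennreal (2 powr \<alpha>)" ?m "ennreal (R powr \<alpha>)"]
        by (simp add: mult.commute)
      also have "\<dots> \<le> ennreal (2 powr \<alpha>) * C"
        by (intro mult_left_mono order.trans[OF SUP_upper less_imp_le[OF elim(1)]]) auto
      finally show "emeasure \<rho> (half_open_cube a R) / ennreal (R powr \<alpha>)
          \<le> ennreal (2 powr \<alpha>) * C" .
    qed
  qed
  then have "upper_beurling_density \<alpha> \<rho> \<le> ennreal (2 powr \<alpha>) * C"
    unfolding upper_beurling_density_eq_cubes by (rule Limsup_bounded)
  also have "\<dots> < \<infinity>"
    using C(2) by (simp add: ennreal_mult_less_top)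
  finally show False using inf by simp
qed

lemma beurling_dim_mono_of_doubled_cubes:
  fixes \<rho> \<mu> :: "(real ^ 'n) measure"
  assumes "eventually (\<lambda>R. \<forall>a. \<exists>b.
      emeasure \<rho> (half_open_cube a R) \<le> emeasure \<mu> (half_open_cube b (2 * R))) at_top"
  shows "beurling_dim \<rho> \<le> beurling_dim \<mu>"
  unfolding beurling_dim_def
  using upper_beurling_density_infinite_mono[OF assms] by (intro SUP_subset_mono) auto

section \<open>Invariance of the dimension under discretisation\<close>

theorem theorem3p5:
  fixes \<nu> \<nu>' :: "(real ^ 'n) measure"
    and r :: real
    and x :: "int ^ 'n \<Rightarrow> real ^ 'n"
  assumes "sets \<nu> = sets borel"
    and "locally_finite_measure \<nu>"
    and "r > 0"
    and "\<And>k. x k \<in> lattice_cell r k"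
  defines "\<nu>' \<equiv> borel_measure_sum
             (\<lambda>k. scale_measure (emeasure \<nu> (lattice_cell r k)) (return borel (x k)))"
  shows "beurling_dim \<nu>' = beurling_dim \<nu>"
proof -
  let ?U = "\<lambda>A. \<Union>k\<in>{k. x k \<in> A}. lattice_cell r k"
  have \<nu>': "emeasure \<nu>' (half_open_cube a R) = emeasure \<nu> (?U (half_open_cube a R))" for a R
    unfolding \<nu>'_def by (rule emeasure_discretisation[OF assms(1,3) half_open_cube_borel])
  have U_sets: "?U A \<in> sets \<nu>" for A
    unfolding assms(1) by (intro sets.countable_UN'' lattice_cell_borel assms(3)) simp
  \<comment> \<open>A cell whose point lies in the cube is contained in the enlarged cube.\<close>
  have le1: "emeasure \<nu>' (half_open_cube a R)
      \<le> emeasure \<nu> (half_open_cube (a - (\<chi> i. r)) (2 * R))" if "R \<ge> 2 * r" for a R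
    unfolding \<nu>' using assms(1) half_open_cube_enlarge[OF assms(3) that _ assms(4)]
    by (intro emeasure_mono) (auto simp: half_open_cube_borel)
  \<comment> \<open>A cell that meets the cube has its point in the enlarged cube, so its mass is counted there.\<close>
  have le2: "emeasure \<nu> (half_open_cube a R)
      \<le> emeasure \<nu>' (half_open_cube (a - (\<chi> i. r)) (2 * R))" if "R \<ge> 2 * r" for a R
    unfolding \<nu>'
  proof (rule emeasure_mono[OF subsetI U_sets])
    fix y assume y: "y \<in> half_open_cube a R"
    obtain k where k: "y \<in> lattice_cell r k"
      using lattice_cells_cover[OF assms(3)] .
    then have "x k \<in> half_open_cube (a - (\<chi> i. r)) (2 * R)"
      using half_open_cube_enlarge[OF assms(3) that y k assms(4)] by simp
    with k show "y \<in> ?U (half_open_cube (a - (\<chi> i. r)) (2 * R))" by blast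
  qed
  show ?thesis
  proof (rule antisym)
    show "beurling_dim \<nu>' \<le> beurling_dim \<nu>"
      by (rule beurling_dim_mono_of_doubled_cubes,
          rule eventually_mono[OF eventually_ge_at_top[of "2 * r"]]) (use le1 in blast)
    show "beurling_dim \<nu> \<le> beurling_dim \<nu>'"
      by (rule beurling_dim_mono_of_doubled_cubes,
          rule eventually_mono[OF eventually_ge_at_top[of "2 * r"]]) (use le2 in blast)
  qed
qed

end
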